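(* The $2$-colour parity is equivalent to the Gaussian parity on virtual knots: for every virtual knot diagram $D$ (with an orientation), every $2$-colouring $\mathscr{C}$ of $D$, and every classical crossing $c$ of $D$, one has $\mathfrak{p}_{\mathscr{C}}(c)=1$ if and only if $c$ is G-odd.
   Context: A virtual knot diagram is a generic immersion of one circle in the plane whose double points are marked either as classical crossings (with over/under information) or virtual crossings; a virtual knot is a one-component virtual link. Shadow: $S(D)$ is obtained from $D$ by forgetting the over/under decoration at classical crossings, which become flat crossings. The arcs of $S(D)$ run between flat crossings (passing straight through virtual crossings); a component without classical crossings is a single arc. A $2$-colouring $\mathscr{C}$ of $D$ is a colouring of the arcs of $S(D)$, each arc exactly one of red and green, such that at every flat crossing the four incident arc-ends are, in cyclic order and up to rotation, red, red, green, green; equivalently, on each of the two strands through a flat crossing the colour changes when passing straight through the crossing. $2$-colour parity: for an oriented diagram $D$ with $2$-colouring $\mathscr{C}$ and a classical crossing $c$, $\mathfrak{p}_{\mathscr{C}}(c)=0$ ($c$ is even) if the two arcs oriented into $c$ have different colours, and $\mathfrak{p}_{\mathscr{C}}(c)=1$ ($c$ is odd) if the two arcs oriented into $c$ have the same colour. Gaussian parity: the simple Gauss diagram $G(D)$ of a virtual knot diagram $D$ is a circle on which the classical crossings are marked in the order they are met when traversing $D$ (virtual crossings are ignored), each crossing being met twice, with a chord joining the two occurrences of each crossing. A classical crossing $c$ is G-even if one passes an even number of chord endpoints when travelling along the circle between the two endpoints of the chord associated to $c$ (in either direction); otherwise it is G-odd. *)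

theory Defs
  imports "HOL-Analysis.Analysis"
begin

section \<open>Virtual knot diagrams\<close>

text \<open>
  The plane is the type of complex numbers and the source of a knot diagram is the unit circle
  \<open>sphere 0 1\<close>. A map \<open>f\<close> on the circle is a total function of which only the values on the unit
  circle matter. The curve \<open>s \<mapsto> u * cis s\<close> runs counterclockwise through the circle, starting
  at \<open>u\<close>.
\<close>

abbreviation circle :: "complex set" where
  "circle \<equiv> sphere 0 1"

definition velocity :: "(complex \<Rightarrow> complex) \<Rightarrow> complex \<Rightarrow> complex" where
  "velocity f u = vector_derivative (\<lambda>s. f (u * cis s)) (at 0)"

definition preimages :: "(complex \<Rightarrow> complex) \<Rightarrow> complex \<Rightarrow> complex set" where
  "preimages f p = {u \<in> circle. f u = p}"

definition double_points :: "(complex \<Rightarrow> complex) \<Rightarrow> complex set" where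
  "double_points f = {p. card (preimages f p) = 2}"

text \<open>The determinant of the pair \<open>(a, b)\<close> of plane vectors; it is positive iff \<open>b\<close> points to the
  left of \<open>a\<close>, and zero iff \<open>a\<close> and \<open>b\<close> are linearly dependent.\<close>

definition plane_det :: "complex \<Rightarrow> complex \<Rightarrow> real" where
  "plane_det a b = Re a * Im b - Im a * Re b"

text \<open>An immersion of the circle (of class \<open>C\<^sup>1\<close>, so in particular every smooth one) is generic if
  its multiple points are finitely many transverse double points.\<close>

definition generic_immersion :: "(complex \<Rightarrow> complex) \<Rightarrow> bool" where
  "generic_immersion f \<longleftrightarrow>
     (\<lambda>s. f (cis s)) C1_differentiable_on UNIV \<and>
     (\<forall>u\<in>circle. velocity f u \<noteq> 0) \<and>
     finite (double_points f) \<and>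
     (\<forall>u\<in>circle. \<forall>v\<in>circle. u \<noteq> v \<and> f u = f v \<longrightarrow>
        f u \<in> double_points f \<and> plane_det (velocity f u) (velocity f v) \<noteq> 0)"

text \<open>In a shadow, \<open>crossings\<close> are the flat crossings, as points of the plane; the remaining double
  points of \<open>curve\<close> are the virtual crossings. A diagram has in addition over/under information:
  \<open>over D c\<close> is the point of the circle whose strand is the upper one at \<open>c\<close>. The shadow of a
  diagram is obtained by the generated function \<open>shadow.truncate\<close>.\<close>

record shadow =
  curve :: "complex \<Rightarrow> complex"
  crossings :: "complex set"

record diagram = shadow +
  over :: "complex \<Rightarrow> complex"

definition virtual_knot_diagram :: "diagram \<Rightarrow> bool" where
  "virtual_knot_diagram D \<longleftrightarrow>
     generic_immersion (curve D) \<and>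
     crossings D \<subseteq> double_points (curve D) \<and>
     (\<forall>c\<in>crossings D. over D c \<in> preimages (curve D) c)"

section \<open>Two-colourings\<close>

text \<open>Arcs are recorded as subsets of the source circle, because an arc may cross itself or another
  arc in the plane at virtual crossings. Without flat crossings, the whole circle is the only arc.\<close>

definition arcs :: "shadow \<Rightarrow> complex set set" where
  "arcs S = components (circle - {u \<in> circle. curve S u \<in> crossings S})"

text \<open>The arcs immediately before and immediately after a point \<open>u\<close> of the circle that is mapped to
  a flat crossing, in the counterclockwise direction.\<close>

definition arc_before :: "shadow \<Rightarrow> complex \<Rightarrow> complex set" where
  "arc_before S u = (THE A. A \<in> arcs S \<and> (\<forall>\<^sub>F s in at_left 0. u * cis s \<in> A))"

definition arc_after :: "shadow \<Rightarrow> complex \<Rightarrow> complex set" where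
  "arc_after S u = (THE A. A \<in> arcs S \<and> (\<forall>\<^sub>F s in at_right 0. u * cis s \<in> A))"

text \<open>The four arc-ends at the flat crossing with preimages \<open>u\<close> and \<open>v\<close>, in counterclockwise
  order in the plane: the outgoing ends leave in the directions of the velocities, the incoming ones
  lie in the opposite directions.\<close>

definition arc_ends :: "shadow \<Rightarrow> complex \<Rightarrow> complex \<Rightarrow> complex set list" where
  "arc_ends S u v =
     (if plane_det (velocity (curve S) u) (velocity (curve S) v) > 0
      then [arc_after S u, arc_after S v, arc_before S u, arc_before S v]
      else [arc_after S u, arc_before S v, arc_before S u, arc_after S v])"

datatype colour = Red | Green

text \<open>Only the values of \<open>C\<close> on arcs matter.\<close>

definition two_colouring :: "diagram \<Rightarrow> (complex set \<Rightarrow> colour) \<Rightarrow> bool" where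
  "two_colouring D C \<longleftrightarrow>
     (let S = shadow.truncate D in
      \<forall>c\<in>crossings S. \<forall>u\<in>preimages (curve S) c. \<forall>v\<in>preimages (curve S) c. u \<noteq> v \<longrightarrow>
        (\<exists>k. rotate k (map C (arc_ends S u v)) = [Red, Red, Green, Green]))"

lemma rotation_of_red_red_green_green_iff:
  "(\<exists>k. rotate k [a, b, c, d] = [Red, Red, Green, Green]) \<longleftrightarrow> a \<noteq> c \<and> b \<noteq> d"
proof
  assume "\<exists>k. rotate k [a, b, c, d] = [Red, Red, Green, Green]"
  then obtain k where "rotate k [a, b, c, d] = [Red, Red, Green, Green]" ..
  then have r: "rotate (k mod 4) [a, b, c, d] = [Red, Red, Green, Green]"
    using rotate_conv_mod[of k "[a, b, c, d]"] by simp
  have "k mod 4 < 4" by simp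
  then have "k mod 4 = 0 \<or> k mod 4 = 1 \<or> k mod 4 = 2 \<or> k mod 4 = 3" by linarith
  then show "a \<noteq> c \<and> b \<noteq> d"
    using r by (elim disjE) (simp_all add: numeral_2_eq_2 numeral_3_eq_3 rotate_def)
next
  assume "a \<noteq> c \<and> b \<noteq> d"
  then have "rotate 0 [a, b, c, d] = [Red, Red, Green, Green] \<or>
    rotate (Suc 0) [a, b, c, d] = [Red, Red, Green, Green] \<or>
    rotate (Suc (Suc 0)) [a, b, c, d] = [Red, Red, Green, Green] \<or>
    rotate (Suc (Suc (Suc 0))) [a, b, c, d] = [Red, Red, Green, Green]"
    by (cases a; cases b; cases c; cases d) (simp_all add: rotate_def)
  then show "\<exists>k. rotate k [a, b, c, d] = [Red, Red, Green, Green]" by blast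
qed

text \<open>Equivalently, the colour changes on each strand passing straight through a flat crossing.\<close>

lemma two_colouring_iff_changes:
  "two_colouring D C \<longleftrightarrow>
     (let S = shadow.truncate D in
      \<forall>c\<in>crossings S. \<forall>u\<in>preimages (curve S) c. \<forall>v\<in>preimages (curve S) c. u \<noteq> v \<longrightarrow>
        C (arc_before S u) \<noteq> C (arc_after S u) \<and> C (arc_before S v) \<noteq> C (arc_after S v))"
proof -
  have "(\<exists>k. rotate k (map C (arc_ends S u v)) = [Red, Red, Green, Green]) \<longleftrightarrow>
      C (arc_before S u) \<noteq> C (arc_after S u) \<and> C (arc_before S v) \<noteq> C (arc_after S v)" for S u v
    unfolding arc_ends_def if_distrib[of "map C"] list.map
    by (cases "plane_det (velocity (curve S) u) (velocity (curve S) v) > 0")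
      (auto simp: rotation_of_red_red_green_green_iff)
  then show ?thesis
    by (simp only: two_colouring_def)
qed

section \<open>The two parities\<close>

text \<open>An orientation of a knot diagram is one of the two orientations of its source circle.\<close>

datatype orientation = Counterclockwise | Clockwise

fun arc_into :: "orientation \<Rightarrow> shadow \<Rightarrow> complex \<Rightarrow> complex set" where
  "arc_into Counterclockwise S u = arc_before S u"
| "arc_into Clockwise S u = arc_after S u"

definition colour_parity ::
  "diagram \<Rightarrow> orientation \<Rightarrow> (complex set \<Rightarrow> colour) \<Rightarrow> complex \<Rightarrow> nat" where
  "colour_parity D ori C c =
     (let S = shadow.truncate D in
      if \<forall>u\<in>preimages (curve S) c. \<forall>v\<in>preimages (curve S) c.
           C (arc_into ori S u) = C (arc_into ori S v)
      then 1 else 0)"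

text \<open>The simple Gauss diagram is drawn on the source circle itself and is represented by the set of
  its chords, a chord being the set of its two endpoints.\<close>

definition gauss_diagram :: "diagram \<Rightarrow> complex set set" where
  "gauss_diagram D = preimages (curve D) ` crossings D"

text \<open>The points passed when travelling counterclockwise from \<open>u\<close> to \<open>v\<close>, without \<open>u\<close> and \<open>v\<close>.\<close>

definition circle_between :: "complex \<Rightarrow> complex \<Rightarrow> complex set" where
  "circle_between u v = {u * cis s |s. \<exists>t. 0 < s \<and> s < t \<and> t < 2 * pi \<and> v = u * cis t}"

text \<open>As \<open>u\<close> and \<open>v\<close> may be exchanged, both directions of travel are covered.\<close>

definition G_even :: "diagram \<Rightarrow> complex \<Rightarrow> bool" where
  "G_even D c \<longleftrightarrow>
     (\<forall>u\<in>preimages (curve D) c. \<forall>v\<in>preimages (curve D) c. u \<noteq> v \<longrightarrow>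
        even (card (circle_between u v \<inter> \<Union>(gauss_diagram D))))"

abbreviation G_odd :: "diagram \<Rightarrow> complex \<Rightarrow> bool" where
  "G_odd D c \<equiv> \<not> G_even D c"

end

theory Submission
  imports Defs
begin

text \<open>
  Travel along the circle from one endpoint \<open>u\<close> of a chord to the other endpoint \<open>v\<close>. The colour is
  constant between consecutive chord endpoints and changes at each of them, so the arc leaving
  \<open>u\<close> and the arc entering \<open>v\<close> have the same colour iff an even number of endpoints is passed. Since
  the colour also changes at \<open>u\<close>, the arcs entering \<open>u\<close> and \<open>v\<close> have the same colour iff that number
  is odd.
\<close>

lemma arcs_eqI:
  assumes "A \<in> arcs S" "B \<in> arcs S" "x \<in> A" "x \<in> B"
  shows "A = B"
  using assms components_eq unfolding arcs_def by blast

text \<open>Serves \<open>arc_before\<close> and \<open>arc_after\<close> alike, with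
  \<open>F\<close> a one-sided filter at 0. Since \<open>F\<close> is nontrivial, two arcs that
  eventually contain \<open>g s\<close> share a point, and distinct components are disjoint.\<close>

lemma the_arc_eqI:
  assumes "F \<noteq> bot" "A \<in> arcs S" "\<forall>\<^sub>F s in F. g s \<in> A"
  shows "(THE B. B \<in> arcs S \<and> (\<forall>\<^sub>F s in F. g s \<in> B)) = A"
proof (rule the_equality)
  fix B assume B: "B \<in> arcs S \<and> (\<forall>\<^sub>F s in F. g s \<in> B)"
  then have "\<forall>\<^sub>F s in F. g s \<in> A \<and> g s \<in> B"
    using assms(3) by (simp add: eventually_conj_iff)
  then obtain s where "g s \<in> A" "g s \<in> B"
    using eventually_happens' assms(1) by blast
  then show "B = A"
    using B assms(2) arcs_eqI by blast
qed (use assms in blast)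

text \<open>The open stretch between the angles 0 and \<open>t\<close> is connected and avoids the
  flat crossings, so it lies inside one arc, which is then the neighbour at both ends.\<close>

lemma arc_after_eq_arc_before:
  assumes "u \<in> circle" "0 < t"
    and "\<And>s. 0 < s \<Longrightarrow> s < t \<Longrightarrow> curve S (u * cis s) \<notin> crossings S"
  shows "arc_after S u = arc_before S (u * cis t)"
proof -
  let ?Q = "(\<lambda>s. u * cis s) ` {0<..<t}"
  have "connected ?Q"
    by (intro connected_continuous_image continuous_intros) auto
  moreover have "?Q \<subseteq> circle - {w \<in> circle. curve S w \<in> crossings S}"
    using assms by (auto simp: norm_mult)
  \<comment> \<open>An empty set has no components; the midpoint of the stretch excludes this
    case.\<close>
  moreover have "circle - {w \<in> circle. curve S w \<in> crossings S} \<noteq> {}"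
  proof -
    have "u * cis (t / 2) \<in> ?Q"
      using assms(2) by (intro imageI) simp
    then show ?thesis
      using calculation(2) by blast
  qed
  ultimately obtain A where A: "A \<in> arcs S" "?Q \<subseteq> A"
    unfolding arcs_def using exists_component_superset by blast
  have "\<forall>\<^sub>F s in at_right 0. u * cis s \<in> A"
    using eventually_at_right_real[OF assms(2)] by eventually_elim (rule subsetD[OF A(2) imageI])
  then have "arc_after S u = A"
    unfolding arc_after_def using A by (intro the_arc_eqI) auto
  moreover have "\<forall>\<^sub>F s in at_left 0. u * cis t * cis s \<in> A"
  proof -
    have "u * cis t * cis s \<in> A" if "s \<in> {- t<..<0}" for s
    proof -
      have "u * cis (t + s) \<in> A"
        using that by (intro subsetD[OF A(2)] imageI) simp
      then show ?thesis by (simp add: cis_mult mult.assoc)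
    qed
    then show ?thesis
      using eventually_at_left_real[of "- t" 0] assms(2) by (auto elim: eventually_mono)
  qed
  then have "arc_before S (u * cis t) = A"
    unfolding arc_before_def using A by (intro the_arc_eqI) auto
  ultimately show ?thesis by simp
qed

text \<open>With only two colours a change of colour acts as negation, which turns counting into
  parity.\<close>

lemma colour_neq_trans:
  fixes a b d :: colour
  assumes "a \<noteq> b"
  shows "b = d \<longleftrightarrow> a \<noteq> d"
  using assms by (cases a; cases b; cases d; simp)

text \<open>Crossings are counted by their angles. The induction on their number keeps
  \<open>t\<close> arbitrary, because splitting off the last crossing shortens the stretch.\<close>

lemma same_colour_iff_even_card:
  assumes "u \<in> circle" "0 < t"
    and "finite {s \<in> {0<..<t}. curve S (u * cis s) \<in> crossings S}"
    and changes: "\<And>w. w \<in> circle \<Longrightarrow> curve S w \<in> crossings S \<Longrightarrow>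
      C (arc_before S w) \<noteq> (C (arc_after S w) :: colour)"
  shows "C (arc_after S u) = C (arc_before S (u * cis t)) \<longleftrightarrow>
    even (card {s \<in> {0<..<t}. curve S (u * cis s) \<in> crossings S})"
  using assms(2,3)
proof (induction "card {s \<in> {0<..<t}. curve S (u * cis s) \<in> crossings S}" arbitrary: t)
  case 0
  then have "\<And>s. 0 < s \<Longrightarrow> s < t \<Longrightarrow> curve S (u * cis s) \<notin> crossings S"
    by auto
  then show ?case
    using arc_after_eq_arc_before[OF assms(1) \<open>0 < t\<close>] unfolding "0.hyps"[symmetric] by simp
next
  case (Suc n)
  let ?T = "\<lambda>t. {s \<in> {0<..<t}. curve S (u * cis s) \<in> crossings S}"
  \<comment> \<open>The last crossing before \<open>t\<close>. The open interval below
    \<open>m\<close> omits \<open>m\<close>, so it holds exactly one crossing fewer and the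
    induction hypothesis applies with \<open>m\<close> for \<open>t\<close>.\<close>
  define m where "m = Max (?T t)"
  have "?T t \<noteq> {}"
    using Suc.hyps(2) by (metis card.empty nat.distinct(1))
  then have m: "m \<in> ?T t" and le_m: "\<And>s. s \<in> ?T t \<Longrightarrow> s \<le> m"
    unfolding m_def using Suc.prems(2) Max_in Max_ge by blast+
  have "s \<in> ?T t \<longleftrightarrow> s \<in> insert m (?T m)" for s
    using m le_m[of s] by fastforce
  then have T: "?T t = insert m (?T m)" by blast
  then have fin: "finite (?T m)"
    using Suc.prems(2) by (simp only: finite_insert)
  then have "card (?T t) = Suc (card (?T m))"
    unfolding T by (rule card_insert_disjoint) simp
  then have n: "n = card (?T m)"
    using Suc.hyps(2) by simp
  let ?w = "u * cis m"
  have w: "?w \<in> circle" using assms(1) by (simp add: norm_mult)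
  have "arc_after S ?w = arc_before S (?w * cis (t - m))"
  proof (rule arc_after_eq_arc_before[OF w])
    fix s assume "0 < s" "s < t - m"
    then show "curve S (?w * cis s) \<notin> crossings S"
      using m le_m[of "m + s"] by (auto simp: mult.assoc cis_mult)
  qed (use m in simp)
  then have "arc_after S ?w = arc_before S (u * cis t)"
    by (simp add: mult.assoc cis_mult)
  moreover have "C (arc_after S ?w) = C (arc_after S u) \<longleftrightarrow> C (arc_before S ?w) \<noteq> C (arc_after S u)"
    using changes[OF w] m by (intro colour_neq_trans) simp
  moreover have "C (arc_after S u) = C (arc_before S ?w) \<longleftrightarrow> even n"
    using Suc.hyps(1)[OF n _ fin] m unfolding n[symmetric] by simp
  ultimately have "C (arc_after S u) = C (arc_before S (u * cis t)) \<longleftrightarrow> odd n"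
    by argo
  then show ?case
    unfolding Suc.hyps(2)[symmetric] by simp
qed

lemma inj_on_mult_cis:
  assumes "u \<noteq> 0"
  shows "inj_on (\<lambda>s. u * cis s) {0..<2 * pi}"
proof (rule inj_onI)
  fix s t assume st: "s \<in> {0..<2 * pi}" "t \<in> {0..<2 * pi}" "u * cis s = u * cis t"
  \<comment> \<open>On this half-open range \<open>Arg2pi\<close> inverts \<open>cis\<close>, so
    after cancelling \<open>u\<close> equal points have equal angles.\<close>
  have "Arg2pi (cis r) = r" if "r \<in> {0..<2 * pi}" for r
    using that Arg2pi_unique[of 1 r "cis r"] by (simp add: cis_conv_exp)
  then show "s = t"
    using st assms by (metis mult_left_cancel)
qed

lemma circle_points_differ_by_angle:
  assumes "u \<in> circle" "v \<in> circle" "u \<noteq> v"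
  obtains t where "0 < t" "t < 2 * pi" "v = u * cis t"
proof -
  define t where "t = Arg2pi (v / u)"
  have "norm (v / u) = 1" "u \<noteq> 0"
    using assms by (auto simp: norm_divide)
  then have "v = u * cis t"
    using Arg2pi_eq[of "v / u"] by (simp add: t_def cis_conv_exp field_simps)
  moreover have "0 < t"
    using calculation assms(3) Arg2pi_ge_0[of "v / u"] unfolding t_def
    by (metis cis_zero less_eq_real_def mult.right_neutral)
  moreover have "t < 2 * pi"
    unfolding t_def by (rule Arg2pi_lt_2pi)
  ultimately show ?thesis
    by (intro that)
qed

text \<open>The definition hides the end angle behind an existential; injectivity over one turn
  identifies it with \<open>t\<close>.\<close>

lemma circle_between_mult_cis:
  assumes "u \<noteq> 0" "0 < t" "t < 2 * pi"
  shows "circle_between u (u * cis t) = (\<lambda>s. u * cis s) ` {0<..<t}"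
proof -
  have "t' = t" if "0 < t'" "t' < 2 * pi" "u * cis t = u * cis t'" for t'
    using inj_onD[OF inj_on_mult_cis[OF assms(1)] that(3)] that assms by simp
  then have "(\<exists>t'. 0 < s \<and> s < t' \<and> t' < 2 * pi \<and> u * cis t = u * cis t') \<longleftrightarrow> s \<in> {0<..<t}" for s
    using assms(3) by (metis greaterThanLessThan_iff less_trans)
  then show ?thesis
    unfolding circle_between_def by (simp only: Setcompr_eq_image Collect_mem_eq)
qed

lemma finite_chord_endpoints:
  assumes "virtual_knot_diagram D"
  shows "finite (\<Union>(gauss_diagram D))"
proof -
  have sub: "crossings D \<subseteq> double_points (curve D)" "finite (double_points (curve D))"
    using assms by (auto simp: virtual_knot_diagram_def generic_immersion_def)
  \<comment> \<open>Infinite sets have \<open>card\<close> 0, so cardinality 2 yields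
    finiteness.\<close>
  moreover have "finite (preimages (curve D) c)" if "c \<in> crossings D" for c
    using sub(1) that by (intro card_ge_0_finite) (auto simp: double_points_def)
  ultimately show ?thesis
    unfolding gauss_diagram_def by (auto intro: finite_subset)
qed

text \<open>Ties the two parities together: the points counted in the Gauss diagram are those cut
  out of the circle to form \<open>arcs\<close>.\<close>

lemma chord_endpoints_eq:
  "\<Union>(gauss_diagram D) = {w \<in> circle. curve D w \<in> crossings D}"
  by (auto simp: gauss_diagram_def preimages_def)

lemma colour_changes:
  assumes "virtual_knot_diagram D" "two_colouring D C" "w \<in> circle" "curve D w \<in> crossings D"
  shows "C (arc_before (shadow.truncate D) w) \<noteq> C (arc_after (shadow.truncate D) w)"
proof -
  have "card (preimages (curve D) (curve D w)) = 2"
    using assms(1,4) by (auto simp: virtual_knot_diagram_def double_points_def)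
  moreover have w: "w \<in> preimages (curve D) (curve D w)"
    using assms(3) by (simp add: preimages_def)
  \<comment> \<open>The colouring condition speaks of pairs of distinct preimages, so the second one
    is supplied.\<close>
  ultimately obtain v where "v \<in> preimages (curve D) (curve D w)" "w \<noteq> v"
    by (metis card_2_iff insert_iff)
  then show ?thesis
    using assms(2,4) w by (auto simp: two_colouring_iff_changes shadow.defs Let_def)
qed

text \<open>Either orientation adds one colour change to the comparison of the arc after
  \<open>u\<close> with the arc before \<open>v\<close>: at \<open>u\<close> if counterclockwise, at
  \<open>v\<close> if clockwise.\<close>

lemma same_incoming_colour_iff_odd_card:
  assumes D: "virtual_knot_diagram D" and C: "two_colouring D C"
    and u: "u \<in> circle" "curve D u \<in> crossings D"
    and v: "v \<in> circle" "curve D v \<in> crossings D" and "u \<noteq> v"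
  shows "C (arc_into ori (shadow.truncate D) u) = C (arc_into ori (shadow.truncate D) v) \<longleftrightarrow>
    odd (card (circle_between u v \<inter> \<Union>(gauss_diagram D)))"
proof -
  let ?S = "shadow.truncate D"
  obtain t where t: "0 < t" "t < 2 * pi" "v = u * cis t"
    using circle_points_differ_by_angle u v \<open>u \<noteq> v\<close> by metis
  let ?T = "{s \<in> {0<..<t}. curve D (u * cis s) \<in> crossings D}"
  have "u \<noteq> 0" using u by auto
  have eq: "circle_between u v \<inter> \<Union>(gauss_diagram D) = (\<lambda>s. u * cis s) ` ?T"
    unfolding t(3) circle_between_mult_cis[OF \<open>u \<noteq> 0\<close> t(1,2)] chord_endpoints_eq using u
    by (auto simp: norm_mult)
  \<comment> \<open>Injectivity carries finiteness and cardinality between points of the circle and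
    angles.\<close>
  have inj: "inj_on (\<lambda>s. u * cis s) ?T"
    using t by (intro inj_on_subset[OF inj_on_mult_cis[OF \<open>u \<noteq> 0\<close>]]) auto
  have "finite ?T"
    using finite_imageD[OF _ inj] eq finite_chord_endpoints[OF D] by (metis finite_Int)
  then have "C (arc_after ?S u) = C (arc_before ?S v) \<longleftrightarrow> even (card ?T)"
    using same_colour_iff_even_card[of u t ?S C] colour_changes[OF D C] u(1) t
    by (simp add: shadow.defs)
  moreover have "card ?T = card (circle_between u v \<inter> \<Union>(gauss_diagram D))"
    unfolding eq using card_image[OF inj] by simp
  moreover have "C (arc_after ?S w) = d \<longleftrightarrow> C (arc_before ?S w) \<noteq> d" if "w \<in> {u, v}" for w d
    using that colour_changes[OF D C] u v by (intro colour_neq_trans) blast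
  then have "C (arc_after ?S u) = d \<longleftrightarrow> C (arc_before ?S u) \<noteq> d"
    "C (arc_after ?S v) = d \<longleftrightarrow> C (arc_before ?S v) \<noteq> d" for d
    by blast+
  ultimately show ?thesis
    by (cases ori; simp only: arc_into.simps; metis)
qed

theorem proposition2p15:
  fixes D :: diagram and ori :: orientation and C :: "complex set \<Rightarrow> colour" and c :: complex
  assumes "virtual_knot_diagram D"
    and "two_colouring D C"
    and "c \<in> crossings D"
  shows "colour_parity D ori C c = 1 \<longleftrightarrow> G_odd D c"
proof -
  let ?S = "shadow.truncate D"
  let ?even = "\<lambda>u v. even (card (circle_between u v \<inter> \<Union>(gauss_diagram D)))"
  have "card (preimages (curve D) c) = 2"
    using assms(1,3) by (auto simp: virtual_knot_diagram_def double_points_def)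
  then obtain u v where uv: "preimages (curve D) c = {u, v}" "u \<noteq> v"
    by (auto simp: card_2_iff)
  then have "u \<in> preimages (curve D) c" "v \<in> preimages (curve D) c"
    by auto
  then have "u \<in> circle" "curve D u \<in> crossings D" "v \<in> circle" "curve D v \<in> crossings D"
    using assms(3) by (auto simp: preimages_def)
  \<comment> \<open>\<open>G_even\<close> demands evenness in both directions of travel. Equality of
    colours is symmetric, so the two counts have the same parity.\<close>
  then have "C (arc_into ori ?S u) = C (arc_into ori ?S v) \<longleftrightarrow> \<not> ?even u v"
    "C (arc_into ori ?S v) = C (arc_into ori ?S u) \<longleftrightarrow> \<not> ?even v u"
    using same_incoming_colour_iff_odd_card[OF assms(1,2)] uv(2) by metis+
  moreover have "colour_parity D ori C c = 1 \<longleftrightarrow> C (arc_into ori ?S u) = C (arc_into ori ?S v)"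
    unfolding colour_parity_def Let_def shadow.truncate_def shadow.select_convs uv(1)
    by (simp add: eq_commute)
  moreover have "G_even D c \<longleftrightarrow> ?even u v \<and> ?even v u"
    using uv(2)[symmetric] uv(2)
    by (simp only: G_even_def uv(1) ball_simps simp_thms)
  ultimately show ?thesis by argo
qed

end
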